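(* Let $n\ge3$ and let $X_1,\dots,X_n$ be Banach spaces over $\mathbb{K}\in\{\mathbb{R},\mathbb{C}\}$ of dimension at least $2$. If at least one of the spaces $X_1,\dots,X_n$ is infinite-dimensional, then $\mathcal{L}(^nX_1\times\cdots\times X_n;\mathbb{K})$ fails the $w^*$-KK.
   Context: $\mathcal{L}(^nX_1\times\cdots\times X_n;\mathbb{K})$ is the Banach space of continuous $n$-linear forms on $X_1\times\cdots\times X_n$ with norm $\|A\|=\sup\{|A(x_1,\dots,x_n)|:x_j\in B_{X_j}\}$. It is isometrically the dual of the completed projective tensor product $X_1\widetilde\otimes_\pi\cdots\widetilde\otimes_\pi X_n$, and carries the corresponding weak-star topology (on bounded nets: pointwise convergence). A dual space $E^*$ with fixed predual $E$ has the $w^*$-KK (weak-star Kadec--Klee property) if, whenever $(x^*_\alpha)\subseteq S_{E^*}$ is a net, $x^*\in S_{E^*}$ and $x^*_\alpha\to x^*$ weak-star, then $\|x^*_\alpha-x^*\|\to0$. *)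

theory Defs
  imports "HOL-Analysis.Analysis" "HOL-Library.Poly_Mapping"
begin

text \<open>
  Banach spaces over a field \<open>'k\<close> (real or complex) are rendered as complete linear subspaces of one
  ambient normed space over \<open>'k\<close>. Nothing is lost: given Banach spaces \<open>X\<^sub>1, \<dots>, X\<^sub>n\<close>, take the
  product \<open>X\<^sub>1 \<times> \<dots> \<times> X\<^sub>n\<close> as ambient space and its coordinate subspaces, which are isometric copies
  of the \<open>X\<^sub>i\<close>. Nothing below relates the different \<open>X i\<close> to each other inside the ambient space.

  HOL-Analysis has no class of complex normed spaces, so the scalar multiplication by \<open>'k\<close> is an
  explicit parameter. For \<open>'k = real\<close> the locale forces it to be \<open>scaleR\<close>.
\<close>

locale normed_space_over = vector_space smul
  for smul :: "'k::real_normed_field \<Rightarrow> 'a::real_normed_vector \<Rightarrow> 'a" +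
  assumes scale_of_real: "smul (of_real r) x = r *\<^sub>R x"
    and norm_scale: "norm (smul c x) = norm c * norm x"

definition banach_subspace ::
    "('k::real_normed_field \<Rightarrow> 'a::real_normed_vector \<Rightarrow> 'a) \<Rightarrow> 'a set \<Rightarrow> bool" where
  "banach_subspace smul V \<longleftrightarrow> module.subspace smul V \<and> complete V"

text \<open>The library's \<open>dim\<close> is \<open>0\<close> on infinite-dimensional spaces and is therefore not used.\<close>

definition dim_at_least ::
    "('k::real_normed_field \<Rightarrow> 'a::real_normed_vector \<Rightarrow> 'a) \<Rightarrow> nat \<Rightarrow> 'a set \<Rightarrow> bool" where
  "dim_at_least smul d V \<longleftrightarrow>
     (\<exists>B\<subseteq>V. finite B \<and> card B = d \<and> \<not> module.dependent smul B)"

definition infinite_dimensional ::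
    "('k::real_normed_field \<Rightarrow> 'a::real_normed_vector \<Rightarrow> 'a) \<Rightarrow> 'a set \<Rightarrow> bool" where
  "infinite_dimensional smul V \<longleftrightarrow>
     \<not> (\<exists>B\<subseteq>V. finite B \<and> V \<subseteq> module.span smul B)"


section \<open>The space of continuous multilinear forms\<close>

text \<open>
  Points of \<open>X\<^sub>1 \<times> \<dots> \<times> X\<^sub>n\<close> are the elements of \<open>\<Pi>\<^sub>E i\<in>{1..n}. X i\<close>. Forms are required to vanish
  outside this set, so that they are determined by their values on it and the pointwise operations
  of the function type are the vector space operations.
\<close>

definition multilinear_forms ::
    "('k::real_normed_field \<Rightarrow> 'a::real_normed_vector \<Rightarrow> 'a) \<Rightarrow> nat \<Rightarrow> (nat \<Rightarrow> 'a set)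
      \<Rightarrow> ((nat \<Rightarrow> 'a) \<Rightarrow> 'k) set" where
  "multilinear_forms smul n X =
    {A. (\<forall>x. x \<notin> (\<Pi>\<^sub>E i\<in>{1..n}. X i) \<longrightarrow> A x = 0) \<and>
        (\<forall>x\<in>(\<Pi>\<^sub>E i\<in>{1..n}. X i). \<forall>i\<in>{1..n}. \<forall>y\<in>X i. \<forall>z\<in>X i.
           A (x(i := y + z)) = A (x(i := y)) + A (x(i := z))) \<and>
        (\<forall>x\<in>(\<Pi>\<^sub>E i\<in>{1..n}. X i). \<forall>i\<in>{1..n}. \<forall>c. \<forall>y\<in>X i.
           A (x(i := smul c y)) = c * A (x(i := y)))}"

definition cont_multilinear_forms ::
    "('k::real_normed_field \<Rightarrow> 'a::real_normed_vector \<Rightarrow> 'a) \<Rightarrow> nat \<Rightarrow> (nat \<Rightarrow> 'a set)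
      \<Rightarrow> ((nat \<Rightarrow> 'a) \<Rightarrow> 'k) set" where
  "cont_multilinear_forms smul n X =
    {A \<in> multilinear_forms smul n X.
       continuous_map (product_topology (\<lambda>i. top_of_set (X i)) {1..n}) euclidean A}"

definition form_norm ::
    "nat \<Rightarrow> (nat \<Rightarrow> 'a::real_normed_vector set) \<Rightarrow> ((nat \<Rightarrow> 'a) \<Rightarrow> 'k::real_normed_field) \<Rightarrow> real" where
  "form_norm n X A = (SUP x\<in>(\<Pi>\<^sub>E i\<in>{1..n}. {v \<in> X i. norm v \<le> 1}). norm (A x))"


section \<open>The completed projective tensor product and the weak-star topology\<close>

text \<open>
  A finitely supported function \<open>u\<close> on \<open>X\<^sub>1 \<times> \<dots> \<times> X\<^sub>n\<close> represents the tensor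
  \<open>\<Sum>x. u x \<cdot> x\<^sub>1 \<otimes> \<dots> \<otimes> x\<^sub>n\<close>. By the universal property, two of them represent the same element of
  the algebraic tensor product iff all (not necessarily continuous) \<open>n\<close>-linear forms agree on them.
\<close>

definition tensor_reps ::
    "nat \<Rightarrow> (nat \<Rightarrow> 'a::real_normed_vector set) \<Rightarrow> ((nat \<Rightarrow> 'a) \<Rightarrow>\<^sub>0 'k::real_normed_field) set" where
  "tensor_reps n X = {u. Poly_Mapping.keys u \<subseteq> (\<Pi>\<^sub>E i\<in>{1..n}. X i)}"

definition tensor_apply ::
    "((nat \<Rightarrow> 'a) \<Rightarrow> 'k::real_normed_field) \<Rightarrow> ((nat \<Rightarrow> 'a) \<Rightarrow>\<^sub>0 'k) \<Rightarrow> 'k" where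
  "tensor_apply A u = (\<Sum>x\<in>Poly_Mapping.keys u. Poly_Mapping.lookup u x * A x)"

definition tensor_eq ::
    "('k::real_normed_field \<Rightarrow> 'a::real_normed_vector \<Rightarrow> 'a) \<Rightarrow> nat \<Rightarrow> (nat \<Rightarrow> 'a set)
      \<Rightarrow> ((nat \<Rightarrow> 'a) \<Rightarrow>\<^sub>0 'k) \<Rightarrow> ((nat \<Rightarrow> 'a) \<Rightarrow>\<^sub>0 'k) \<Rightarrow> bool" where
  "tensor_eq smul n X u v \<longleftrightarrow>
     (\<forall>A\<in>multilinear_forms smul n X. tensor_apply A u = tensor_apply A v)"

definition proj_norm ::
    "('k::real_normed_field \<Rightarrow> 'a::real_normed_vector \<Rightarrow> 'a) \<Rightarrow> nat \<Rightarrow> (nat \<Rightarrow> 'a set)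
      \<Rightarrow> ((nat \<Rightarrow> 'a) \<Rightarrow>\<^sub>0 'k) \<Rightarrow> real" where
  "proj_norm smul n X u =
     (INF v\<in>{v \<in> tensor_reps n X. tensor_eq smul n X u v}.
        \<Sum>x\<in>Poly_Mapping.keys v. norm (Poly_Mapping.lookup v x) * (\<Prod>i\<in>{1..n}. norm (x i)))"

text \<open>
  Elements of the completion are represented by Cauchy sequences for the projective norm; a
  continuous form acts on such a sequence by the limit of its values.
\<close>

definition proj_tensor_cauchy ::
    "('k::real_normed_field \<Rightarrow> 'a::real_normed_vector \<Rightarrow> 'a) \<Rightarrow> nat \<Rightarrow> (nat \<Rightarrow> 'a set)
      \<Rightarrow> (nat \<Rightarrow> (nat \<Rightarrow> 'a) \<Rightarrow>\<^sub>0 'k) set" where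
  "proj_tensor_cauchy smul n X =
    {u. (\<forall>k. u k \<in> tensor_reps n X) \<and>
        (\<forall>e>0. \<exists>N. \<forall>k\<ge>N. \<forall>l\<ge>N. proj_norm smul n X (u k - u l) < e)}"

definition proj_pairing ::
    "((nat \<Rightarrow> 'a) \<Rightarrow> 'k::real_normed_field) \<Rightarrow> (nat \<Rightarrow> (nat \<Rightarrow> 'a) \<Rightarrow>\<^sub>0 'k) \<Rightarrow> 'k" where
  "proj_pairing A u = lim (\<lambda>k. tensor_apply A (u k))"

text \<open>
  The coarsest topology on the space of continuous forms that makes \<open>A \<mapsto> \<langle>A, u\<rangle>\<close> continuous for
  every \<open>u\<close> in the completed projective tensor product.
\<close>

definition weak_star_topology ::
    "('k::real_normed_field \<Rightarrow> 'a::real_normed_vector \<Rightarrow> 'a) \<Rightarrow> nat \<Rightarrow> (nat \<Rightarrow> 'a set)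
      \<Rightarrow> ((nat \<Rightarrow> 'a) \<Rightarrow> 'k) topology" where
  "weak_star_topology smul n X =
     pullback_topology (cont_multilinear_forms smul n X)
       (\<lambda>A. \<lambda>u\<in>proj_tensor_cauchy smul n X. proj_pairing A u)
       (product_topology (\<lambda>u. euclidean) (proj_tensor_cauchy smul n X))"


section \<open>The weak-star Kadec--Klee property\<close>

text \<open>
  For a dual space with carrier \<open>D\<close>, norm \<open>nrm\<close> and weak-star topology \<open>T\<close>. Nets are rendered as
  filters: convergence of a net depends only on the filter of its tails, and every filter \<open>F\<close> on
  \<open>D\<close> is the tail filter of a net (indexed by pairs of a member of \<open>F\<close> and a point in it).
\<close>

definition weak_star_KK :: "'d::minus set \<Rightarrow> ('d \<Rightarrow> real) \<Rightarrow> 'd topology \<Rightarrow> bool" where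
  "weak_star_KK D nrm T \<longleftrightarrow>
     (\<forall>F f. f \<in> D \<and> nrm f = 1 \<longrightarrow>
        (\<forall>\<^sub>F g in F. g \<in> D \<and> nrm g = 1) \<longrightarrow>
        limitin T (\<lambda>g. g) f F \<longrightarrow>
        ((\<lambda>g. nrm (g - f)) \<longlongrightarrow> 0) F)"

definition multilinear_forms_KK ::
    "('k::real_normed_field \<Rightarrow> 'a::real_normed_vector \<Rightarrow> 'a) \<Rightarrow> nat \<Rightarrow> (nat \<Rightarrow> 'a set) \<Rightarrow> bool" where
  "multilinear_forms_KK smul n X \<longleftrightarrow>
     weak_star_KK (cont_multilinear_forms smul n X) (form_norm n X) (weak_star_topology smul n X)"

end

theory Submission
  imports Defs
begin

text \<open>
  Let \<open>X p\<close> be infinite-dimensional and let \<open>q\<close>, \<open>r\<close> be two further indices. Two linearly independent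
  functionals on \<open>X i\<close> define an operator into a two-dimensional Hilbert space; after scaling and
  rotating it, its coordinates \<open>f i\<close>, \<open>g i\<close> satisfy \<open>|f i|\<^sup>2 + |g i|\<^sup>2 \<le> \<parallel>\<cdot>\<parallel>\<^sup>2\<close> with \<open>f i\<close> of norm one and
  \<open>g i \<noteq> 0\<close>. Let \<open>A\<close> be the product of all \<open>f i\<close>, and let \<open>B\<close> arise from \<open>A\<close> by replacing \<open>f q\<close>, \<open>f r\<close> by
  \<open>g q\<close>, \<open>g r\<close> and \<open>f p\<close> by a functional of norm at most one that vanishes on a given finite set \<open>S\<close>.
  By the Cauchy--Schwarz inequality in the coordinates \<open>q\<close>, \<open>r\<close>, \<open>|A| + |B| \<le> 1\<close> on the product of the
  unit balls, so \<open>A + B\<close> has norm one because \<open>A\<close> has. As \<open>S\<close> grows, \<open>A + B\<close> tends to \<open>A\<close> weak-star,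
  although the norm of \<open>B\<close> stays bounded below.
\<close>

section \<open>Norming functionals\<close>

definition sublinear :: "('a::real_vector \<Rightarrow> real) \<Rightarrow> bool" where
  "sublinear p \<longleftrightarrow> (\<forall>x y. p (x + y) \<le> p x + p y) \<and> (\<forall>c\<ge>0. \<forall>x. p (c *\<^sub>R x) = c * p x)"

lemma sublinear_add: "sublinear p \<Longrightarrow> p (x + y) \<le> p x + p y"
  and sublinear_scale: "sublinear p \<Longrightarrow> c \<ge> 0 \<Longrightarrow> p (c *\<^sub>R x) = c * p x"
  by (auto simp: sublinear_def)

lemma sublinear_zero: "sublinear p \<Longrightarrow> p 0 = 0"
  using sublinear_scale[of p 0 0] by simp

lemma sublinear_lower: "sublinear p \<Longrightarrow> - p (- x) \<le> p x"
  using sublinear_add[of p x "- x"] sublinear_zero[of p] by simp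

text \<open>
  A minimal sublinear functional \<open>p\<close> must coincide with its flattening in every direction \<open>x\<close>; evaluating
  at \<open>t = 1\<close> gives superadditivity of \<open>p\<close>. This yields the Hahn--Banach theorem without extending
  functionals step by step.
\<close>

definition flatten :: "('a::real_vector \<Rightarrow> real) \<Rightarrow> 'a \<Rightarrow> 'a \<Rightarrow> real" where
  "flatten p x y = (INF t\<in>{0..}. p (y + t *\<^sub>R x) - t * p x)"

lemma flatten_le:
  assumes "sublinear p" "t \<ge> 0"
  shows "flatten p x y \<le> p (y + t *\<^sub>R x) - t * p x"
proof -
  \<comment> \<open>Keeps the infimum finite: \<open>s * p x\<close>, which is
    \<open>p (s *\<^sub>R x)\<close>, is at most
    \<open>p (y + s *\<^sub>R x) + p (- y)\<close>.\<close>
  have "- p (- y) \<le> p (y + s *\<^sub>R x) - s * p x" if "s \<ge> 0" for s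
    using sublinear_add[OF assms(1), of "y + s *\<^sub>R x" "- y"] sublinear_scale[OF assms(1) that, of x]
    by simp
  then have "bdd_below ((\<lambda>t. p (y + t *\<^sub>R x) - t * p x) ` {0..})"
    by (intro bdd_belowI[where m = "- p (- y)"]) auto
  then show ?thesis unfolding flatten_def
    by (rule cINF_lower) (use assms in auto)
qed

lemma flatten_greatest:
  "(\<And>t. t \<ge> 0 \<Longrightarrow> m \<le> p (y + t *\<^sub>R x) - t * p x) \<Longrightarrow> m \<le> flatten p x y"
  unfolding flatten_def by (rule cINF_greatest) auto

text \<open>Parameters \<open>s\<close> for \<open>y\<close> and \<open>t\<close> for
  \<open>z\<close> combine to the parameter \<open>s + t\<close> for \<open>y + z\<close>;
  homogeneity comes from rescaling the parameter to \<open>t / c\<close>.\<close>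

lemma sublinear_flatten:
  assumes p: "sublinear p"
  shows "sublinear (flatten p x)"
  unfolding sublinear_def
proof (intro conjI allI impI)
  fix y z
  have *: "flatten p x (y + z) \<le> (p (y + s *\<^sub>R x) - s * p x) + (p (z + t *\<^sub>R x) - t * p x)"
    if "s \<ge> 0" "t \<ge> 0" for s t
    using flatten_le[OF p, of "s + t" x "y + z"] that
      sublinear_add[OF p, of "y + s *\<^sub>R x" "z + t *\<^sub>R x"]
    by (simp add: algebra_simps)
  \<comment> \<open>The infimum over \<open>s\<close> is taken first, with \<open>t\<close> fixed;
    the infimum over \<open>t\<close> follows.\<close>
  have "flatten p x (y + z) - flatten p x y \<le> p (z + t *\<^sub>R x) - t * p x" if t: "t \<ge> 0" for t
    using flatten_greatest[of "flatten p x (y + z) - (p (z + t *\<^sub>R x) - t * p x)" p y x] *[OF _ t]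
    by force
  then show "flatten p x (y + z) \<le> flatten p x y + flatten p x z"
    using flatten_greatest[of "flatten p x (y + z) - flatten p x y" p z x] by force
next
  fix c :: real and y
  assume "c \<ge> 0"
  \<comment> \<open>One inequality for all positive factors suffices: applied to \<open>1/c\<close>
    and \<open>c *\<^sub>R y\<close> it gives the reverse one.\<close>
  have pos: "c * flatten p x y \<le> flatten p x (c *\<^sub>R y)" if "c > 0" for c y
  proof (rule flatten_greatest)
    fix t :: real assume "t \<ge> 0"
    have "c * flatten p x y \<le> c * (p (y + (t / c) *\<^sub>R x) - (t / c) * p x)"
      using flatten_le[OF p, of "t / c" x y] \<open>c > 0\<close> \<open>t \<ge> 0\<close> by simp
    also have "\<dots> = p (c *\<^sub>R (y + (t / c) *\<^sub>R x)) - t * p x"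
      using \<open>c > 0\<close>
      by (simp add: sublinear_scale[OF p] right_diff_distrib del: scaleR_add_right)
    also have "c *\<^sub>R (y + (t / c) *\<^sub>R x) = c *\<^sub>R y + t *\<^sub>R x"
      using \<open>c > 0\<close> by (simp add: scaleR_add_right)
    finally show "c * flatten p x y \<le> p (c *\<^sub>R y + t *\<^sub>R x) - t * p x" .
  qed
  show "flatten p x (c *\<^sub>R y) = c * flatten p x y"
  proof (cases "c = 0")
    case True
    have "flatten p x 0 = 0"
      using flatten_le[OF p, of 0 x 0] flatten_greatest[of 0 p 0 x] sublinear_zero[OF p]
        sublinear_scale[OF p]
      by force
    then show ?thesis using True by simp
  next
    case False
    then have c: "c > 0" using \<open>c \<ge> 0\<close> by simp
    have "(1/c) * flatten p x (c *\<^sub>R y) \<le> flatten p x y"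
      using pos[of "1/c" "c *\<^sub>R y"] c by simp
    then show ?thesis using pos[OF c, of y] c by (simp add: field_simps)
  qed
qed

lemma minimal_sublinear_additive:
  assumes p: "sublinear p"
    and minimal: "\<And>q. sublinear q \<Longrightarrow> (\<forall>y. q y \<le> p y) \<Longrightarrow> q = p"
  shows "p (x + y) = p x + p y"
proof -
  have "flatten p x = p"
    using flatten_le[OF p, of 0 x] by (intro minimal sublinear_flatten[OF p]) simp
  then have "p y \<le> p (y + x) - p x"
    using flatten_le[OF p, of 1 x y] by simp
  then show ?thesis using sublinear_add[OF p, of x y] by (simp add: add.commute)
qed

text \<open>Zorn's lemma, with the pointwise infimum as lower bound of a chain. Domination by the
  norm keeps that infimum finite, since \<open>p y\<close> is at least \<open>- p (- y)\<close>,
  hence at least \<open>- norm y\<close>.\<close>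

lemma minimal_sublinear_exists:
  fixes q :: "'a::real_normed_vector \<Rightarrow> real"
  assumes q: "sublinear q" and qn: "\<And>y. q y \<le> norm y"
  obtains p where "sublinear p" "\<And>y. p y \<le> q y"
    "\<And>r. sublinear r \<Longrightarrow> (\<forall>y. r y \<le> p y) \<Longrightarrow> r = p"
proof -
  define S where "S = {p. sublinear p \<and> p \<le> q}"
  \<comment> \<open>The order is reversed because \<open>predicate_Zorn\<close> yields maximal
    elements.\<close>
  define R where "R = (\<lambda>p r :: 'a \<Rightarrow> real. r \<le> p)"
  have "\<exists>m\<in>S. \<forall>a\<in>S. R m a \<longrightarrow> a = m"
  proof (rule predicate_Zorn)
    show "partial_order_on S (relation_of R S)"
      by (rule partial_order_on_relation_ofI) (auto simp: R_def)
  next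
    fix C assume C: "C \<in> Chains (relation_of R S)"
    then have CS: "C \<subseteq> S" and chain: "\<And>a b. a \<in> C \<Longrightarrow> b \<in> C \<Longrightarrow> a \<le> b \<or> b \<le> a"
      by (auto simp: Chains_def relation_of_def R_def)
    show "\<exists>u\<in>S. \<forall>a\<in>C. R a u"
    proof (cases "C = {}")
      case True
      then show ?thesis using q by (auto simp: S_def)
    next
      case False
      define u where "u y = (INF p\<in>C. p y)" for y
      have bdd: "bdd_below ((\<lambda>p. p y) ` C)" for y
      proof (intro bdd_belowI2[where m = "- norm y"])
        fix p assume "p \<in> C"
        then have "sublinear p" "p (- y) \<le> q (- y)" using CS by (auto simp: S_def le_fun_def)
        then show "- norm y \<le> p y" using qn[of "- y"] sublinear_lower[of p y] by simp
      qed
      have low: "u y \<le> p y" if "p \<in> C" for p y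
        unfolding u_def by (rule cINF_lower[OF bdd that])
      have great: "m \<le> u y" if "\<And>p. p \<in> C \<Longrightarrow> m \<le> p y" for m y
        unfolding u_def using False that by (intro cINF_greatest) auto
      have sub: "sublinear p" if "p \<in> C" for p using that CS by (auto simp: S_def)
      have add: "u (y + z) \<le> u y + u z" for y z
      proof -
        \<comment> \<open>The smaller of \<open>p\<close> and \<open>r\<close> belongs to the chain
          and lies below both, so its subadditivity gives the bound.\<close>
        have *: "u (y + z) \<le> p y + r z" if "p \<in> C" "r \<in> C" for p r
        proof -
          consider "p \<le> r" | "r \<le> p" using chain[OF \<open>p \<in> C\<close> \<open>r \<in> C\<close>] by blast
          then show ?thesis
          proof cases
            case 1
            then show ?thesis
              using low[OF that(1), of "y + z"] sublinear_add[OF sub[OF that(1)], of y z]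
              by (smt (verit) le_fun_def)
          next
            case 2
            then show ?thesis
              using low[OF that(2), of "y + z"] sublinear_add[OF sub[OF that(2)], of y z]
              by (smt (verit) le_fun_def)
          qed
        qed
        have "u (y + z) - u y \<le> r z" if "r \<in> C" for r
          using great[of "u (y + z) - r z" y] *[OF _ that] by force
        then show ?thesis using great[of "u (y + z) - u y" z] by force
      qed
      have scale: "u (c *\<^sub>R y) = c * u y" if "c \<ge> 0" for c y
      proof (cases "c = 0")
        case True
        have "u 0 = 0"
          using False sublinear_zero[OF sub] low[of _ 0] great[of 0 0] by fastforce
        then show ?thesis using True by simp
      next
        case c: False
        have "c * u y \<le> u (c *\<^sub>R y)"
          using low \<open>c \<ge> 0\<close> by (intro great) (simp add: sublinear_scale[OF sub] mult_left_mono)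
        moreover have "u (c *\<^sub>R y) / c \<le> u y"
        proof (rule great)
          fix p assume "p \<in> C"
          then show "u (c *\<^sub>R y) / c \<le> p y"
            using low[of p "c *\<^sub>R y"] c \<open>c \<ge> 0\<close> by (simp add: sublinear_scale[OF sub] field_simps)
        qed
        ultimately show ?thesis using c \<open>c \<ge> 0\<close> by (simp add: field_simps)
      qed
      obtain p where "p \<in> C" using False by blast
      then have "u y \<le> q y" for y
        using low[of p y] CS by (force simp: S_def le_fun_def intro: order_trans)
      then have "u \<in> S"
        using add scale by (auto simp: S_def sublinear_def le_fun_def)
      then show ?thesis using low by (auto simp: R_def le_fun_def)
    qed
  qed
  then obtain p where p: "p \<in> S" and min: "\<And>a. a \<in> S \<Longrightarrow> a \<le> p \<Longrightarrow> a = p"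
    by (auto simp: R_def)
  show ?thesis
  proof (rule that)
    show "sublinear p" "\<And>y. p y \<le> q y" using p by (auto simp: S_def le_fun_def)
    show "r = p" if "sublinear r" "\<forall>y. r y \<le> p y" for r
      using that p by (intro min) (auto simp: S_def le_fun_def intro: order_trans)
  qed
qed

text \<open>Starting below \<open>flatten norm x\<close> instead of \<open>norm\<close> fixes the
  value at \<open>x\<close>: the parameter \<open>t = 1\<close> shows that
  \<open>flatten norm x (- x)\<close> is at most \<open>- norm x\<close>.\<close>

lemma norming_functional_exists:
  fixes x :: "'a::real_normed_vector"
  obtains u :: "'a \<Rightarrow> real" where "linear u" "\<And>y. \<bar>u y\<bar> \<le> norm y" "u x = norm x"
proof -
  have sn: "sublinear (norm :: 'a \<Rightarrow> real)" by (auto simp: sublinear_def norm_triangle_ineq)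
  have le: "flatten norm x y \<le> norm y" for y using flatten_le[OF sn, of 0 x y] by simp
  obtain p where p: "sublinear p" "\<And>y. p y \<le> flatten norm x y"
    "\<And>r. sublinear r \<Longrightarrow> (\<forall>y. r y \<le> p y) \<Longrightarrow> r = p"
    using minimal_sublinear_exists[OF sublinear_flatten[OF sn, of x] le] by metis
  have add: "p (y + z) = p y + p z" for y z
    by (rule minimal_sublinear_additive[OF p(1,3)])
  then have minus: "p (- y) = - p y" for y
    using add[of y "- y"] sublinear_zero[OF p(1)] by simp
  have "linear p"
  proof (rule linearI)
    fix c :: real and y
    show "p (c *\<^sub>R y) = c *\<^sub>R p y"
      using sublinear_scale[OF p(1), of c y] sublinear_scale[OF p(1), of "- c" y] minus[of "c *\<^sub>R y"]
      by (cases "c \<ge> 0") auto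
  qed (rule add)
  moreover have pn: "p y \<le> norm y" for y using p(2)[of y] le[of y] by linarith
  then have "\<bar>p y\<bar> \<le> norm y" for y using pn[of y] pn[of "- y"] minus[of y] by (simp add: abs_le_iff)
  moreover have "p x = norm x"
    using p(2)[of "- x"] flatten_le[OF sn, of 1 x "- x"] minus[of x] pn[of x] by simp
  ultimately show ?thesis using that by blast
qed

section \<open>Pairs of functionals dominated by the norm\<close>

definition bounded_functional ::
    "('k::real_normed_field \<Rightarrow> 'a::real_normed_vector \<Rightarrow> 'a) \<Rightarrow> ('a \<Rightarrow> 'k) \<Rightarrow> bool" where
  "bounded_functional smul f \<longleftrightarrow>
     (\<forall>x y. f (x + y) = f x + f y) \<and> (\<forall>c x. f (smul c x) = c * f x) \<and>
     (\<exists>K. \<forall>x. norm (f x) \<le> K * norm x)"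

text \<open>
  The parameter \<open>conj\<close> is the identity on the reals and complex conjugation on the complex numbers.
\<close>

locale separated_normed_space = normed_space_over smul
  for smul :: "'k::{real_normed_field,heine_borel} \<Rightarrow> 'a::real_normed_vector \<Rightarrow> 'a" +
  fixes conj :: "'k \<Rightarrow> 'k"
  assumes conj_mult_self: "conj z * z = of_real ((norm z)\<^sup>2)"
    and norm_rotation: "(norm (conj u * a + conj w * b))\<^sup>2 + (norm (u * b - w * a))\<^sup>2
      = ((norm u)\<^sup>2 + (norm w)\<^sup>2) * ((norm a)\<^sup>2 + (norm b)\<^sup>2)"
    and separating: "x \<noteq> 0 \<Longrightarrow> \<exists>f. bounded_functional smul f \<and> f x \<noteq> 0"
begin

lemma functional_add: "bounded_functional smul f \<Longrightarrow> f (x + y) = f x + f y"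
  and functional_scale: "bounded_functional smul f \<Longrightarrow> f (smul c x) = c * f x"
  and functional_bound: "bounded_functional smul f \<Longrightarrow> \<exists>K. \<forall>x. norm (f x) \<le> K * norm x"
  by (auto simp: bounded_functional_def)

lemma functional_zero: "bounded_functional smul f \<Longrightarrow> f 0 = 0"
  using functional_scale[of f 0 0] by simp

lemma functional_diff: "bounded_functional smul f \<Longrightarrow> f (x - y) = f x - f y"
  using functional_add[of f "x - y" y] by simp

lemma functional_combination:
  assumes f: "bounded_functional smul f" and g: "bounded_functional smul g"
  shows "bounded_functional smul (\<lambda>x. a * f x + b * g x)"
proof -
  obtain K L where K: "\<And>x. norm (f x) \<le> K * norm x" and L: "\<And>x. norm (g x) \<le> L * norm x"
    using functional_bound[OF f] functional_bound[OF g] by blast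
  have "norm (a * f x + b * g x) \<le> (norm a * K + norm b * L) * norm x" for x
  proof -
    have "norm (a * f x + b * g x) \<le> norm a * norm (f x) + norm b * norm (g x)"
      by (metis norm_mult norm_triangle_ineq)
    also have "\<dots> \<le> norm a * (K * norm x) + norm b * (L * norm x)"
      by (intro add_mono mult_left_mono K L) auto
    finally show ?thesis by (simp add: algebra_simps)
  qed
  then show ?thesis
    unfolding bounded_functional_def
    by (intro conjI exI[of _ "norm a * K + norm b * L"])
      (auto simp: functional_add[OF f] functional_add[OF g] functional_scale[OF f]
        functional_scale[OF g] distrib_left mult.left_commute)
qed

lemma functional_continuous:
  assumes "bounded_functional smul f"
  shows "continuous_on UNIV f"
proof -
  have "f (r *\<^sub>R x) = r *\<^sub>R f x" for r x
    using functional_scale[OF assms, of "of_real r" x] by (simp add: scale_of_real scaleR_conv_of_real)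
  moreover obtain K where "\<And>x. norm (f x) \<le> norm x * K"
    using functional_bound[OF assms] by (metis mult.commute)
  ultimately have "bounded_linear f"
    by (intro bounded_linear_intro[of f K] functional_add[OF assms])
  then show ?thesis by (simp add: linear_continuous_on)
qed

text \<open>Elimination by induction on \<open>S\<close>: a functional that vanishes on
  \<open>S\<close> is corrected by a multiple of another one so that it also vanishes at the new
  vector \<open>s\<close>.\<close>

lemma functional_separating_span:
  assumes "finite S" "x \<notin> span S"
  shows "\<exists>f. bounded_functional smul f \<and> (\<forall>s\<in>S. f s = 0) \<and> f x \<noteq> 0"
  using assms
proof (induction S arbitrary: x rule: finite_induct)
  case empty
  then show ?case using separating[of x] by (simp add: span_empty)
next
  case (insert s S)
  show ?case
  proof (cases "s \<in> span S")
    case True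
    then have eq: "span (insert s S) = span S" by (rule span_redundant)
    then obtain f where f: "bounded_functional smul f" "\<forall>s\<in>S. f s = 0" "f x \<noteq> 0"
      using insert by blast
    have "span S \<subseteq> {y. f y = 0}"
      using f by (intro span_minimal) (auto simp: subspace_def functional_zero functional_add functional_scale)
    then show ?thesis using f True by blast
  next
    case False
    obtain g where g: "bounded_functional smul g" "\<forall>t\<in>S. g t = 0" "g s \<noteq> 0"
      using insert.IH[OF False] by blast
    \<comment> \<open>The multiple of \<open>s\<close> is chosen so that \<open>g x' = 0\<close>;
      the later correction of \<open>h\<close> by a multiple of \<open>g\<close> then gives the
      value \<open>h x'\<close> at \<open>x\<close>.\<close>
    define x' where "x' = x - smul (g x / g s) s"
    have "x' \<notin> span S"
    proof
      assume "x' \<in> span S"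
      then have "x' + smul (g x / g s) s \<in> span (insert s S)"
        by (meson insertI1 span_add span_base span_mono span_scale subsetD subset_insertI)
      then show False using insert.prems by (simp add: x'_def)
    qed
    then obtain h where h: "bounded_functional smul h" "\<forall>t\<in>S. h t = 0" "h x' \<noteq> 0"
      using insert.IH by blast
    define f where "f y = 1 * h y + (- (h s / g s)) * g y" for y
    have "f x = h x'"
      using g(3) by (simp add: f_def x'_def functional_diff[OF h(1)] functional_scale[OF h(1)])
    moreover have "bounded_functional smul f"
      unfolding f_def by (rule functional_combination[OF h(1) g(1)])
    moreover have "\<forall>t\<in>insert s S. f t = 0"
      using g h by (auto simp: f_def)
    ultimately show ?thesis using h(3) by (intro exI[of _ f]) simp
  qed
qed

text \<open>
  \<open>(u, w)\<close> is a point of maximal norm in the closure of the image of the unit ball under \<open>(f, g)\<close>; \<open>m\<close> is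
  the square of its norm.
\<close>

lemma hilbertian_pair:
  assumes f: "bounded_functional smul f" and g: "bounded_functional smul g"
    and V: "subspace V" and nz: "\<exists>v\<in>V. f v \<noteq> 0"
  obtains m u w where "m > 0" "m = (norm u)\<^sup>2 + (norm w)\<^sup>2"
    "\<And>v. v \<in> V \<Longrightarrow> (norm (f v))\<^sup>2 + (norm (g v))\<^sup>2 \<le> m * (norm v)\<^sup>2"
    "\<And>t. t < 1 \<Longrightarrow> \<exists>v\<in>V. norm v \<le> 1 \<and> norm (conj u * f v + conj w * g v) > t * m"
proof -
  define T where "T v = (f v, g v)" for v
  define U where "U = {v \<in> V. norm v \<le> 1}"
  obtain K L where K: "\<And>x. norm (f x) \<le> K * norm x" and L: "\<And>x. norm (g x) \<le> L * norm x"
    using functional_bound[OF f] functional_bound[OF g] by blast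
  have small: "r * norm v \<le> \<bar>r\<bar>" if "norm v \<le> 1" for r and v :: 'a
    using mult_right_mono[OF abs_ge_self[of r] norm_ge_zero[of v]] mult_left_le[OF that abs_ge_zero[of r]]
    by linarith
  have "norm (T v) \<le> \<bar>K\<bar> + \<bar>L\<bar>" if "v \<in> U" for v
    using that norm_Pair_le[of "f v" "g v"] K[of v] L[of v] small[of v K] small[of v L]
    by (auto simp: T_def U_def)
  then have "bounded (T ` U)" by (auto simp: bounded_iff)
  then have comp: "compact (closure (T ` U))" by simp
  have "0 \<in> U" using subspace_0[OF V] by (simp add: U_def)
  then have "closure (T ` U) \<noteq> {}" by auto
  then obtain z where z: "z \<in> closure (T ` U)" and max: "\<And>y. y \<in> closure (T ` U) \<Longrightarrow> norm y \<le> norm z"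
    using continuous_attains_sup[OF comp, of norm] continuous_on_norm_id by blast
  obtain u w where zuw: "z = (u, w)" by force
  define m where "m = (norm u)\<^sup>2 + (norm w)\<^sup>2"
  have mz: "m = (norm z)\<^sup>2" by (simp add: m_def zuw norm_Pair)
  have bound: "(norm (f v))\<^sup>2 + (norm (g v))\<^sup>2 \<le> m * (norm v)\<^sup>2" if v: "v \<in> V" for v
  proof (cases "v = 0")
    case True
    then show ?thesis by (simp add: functional_zero f g)
  next
    case False
    let ?c = "of_real (inverse (norm v)) :: 'k"
    have "smul ?c v \<in> U" using False v V
      by (auto simp: U_def norm_scale subspace_scale norm_inverse simp del: of_real_inverse)
    then have "norm (T (smul ?c v)) \<le> norm z" using max closure_subset by blast
    then have "(norm (T (smul ?c v)))\<^sup>2 \<le> m" unfolding mz by (intro power_mono) auto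
    moreover have "(norm (T (smul ?c v)))\<^sup>2
        = (inverse (norm v))\<^sup>2 * ((norm (f v))\<^sup>2 + (norm (g v))\<^sup>2)"
      unfolding T_def
      by (simp add: norm_Pair functional_scale[OF f] functional_scale[OF g] norm_mult
          norm_inverse power_mult_distrib distrib_left)
    ultimately have "(inverse (norm v))\<^sup>2 * ((norm (f v))\<^sup>2 + (norm (g v))\<^sup>2) \<le> m"
      by simp
    then show ?thesis using False by (simp add: field_simps)
  qed
  have "m > 0"
  proof -
    obtain v where "v \<in> V" "f v \<noteq> 0" using nz by blast
    then have "0 < (norm (f v))\<^sup>2 + (norm (g v))\<^sup>2" by (simp add: add_pos_nonneg)
    then have "0 < m * (norm v)\<^sup>2" using bound[OF \<open>v \<in> V\<close>] by linarith
    then show ?thesis using zero_le_power2[of "norm v"] by (auto simp: zero_less_mult_iff)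
  qed
  have near: "\<exists>v\<in>V. norm v \<le> 1 \<and> norm (conj u * f v + conj w * g v) > t * m" if "t < 1" for t
  proof -
    have "conj u * u + conj w * w = of_real m"
      by (simp add: conj_mult_self m_def)
    then have "t * m < norm (conj u * fst z + conj w * snd z)"
      using \<open>m > 0\<close> that by (simp add: zuw)
    \<comment> \<open>An open condition that holds at the point \<open>z\<close> of the closure
      holds somewhere in the image itself.\<close>
    moreover have "open {y. t * m < norm (conj u * fst y + conj w * snd y)}"
      by (intro open_Collect_less continuous_intros)
    ultimately have "{y. t * m < norm (conj u * fst y + conj w * snd y)} \<inter> T ` U \<noteq> {}"
      using z open_Int_closure_eq_empty by blast
    then show ?thesis by (auto simp: T_def U_def)
  qed
  show ?thesis using that[OF \<open>m > 0\<close> m_def bound near] .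
qed

text \<open>\<open>hilbertian_pair\<close> with zero as second functional serves to normalise the
  first. Any positive constant in place of \<open>1/2\<close> would do, as long as it is the same
  for all \<open>S\<close>.\<close>

lemma normalised_functional_vanishing:
  assumes V: "subspace V" and "finite S" "\<not> V \<subseteq> span S"
  obtains f where "bounded_functional smul f" "\<And>s. s \<in> S \<Longrightarrow> f s = 0"
    "\<And>v. v \<in> V \<Longrightarrow> norm (f v) \<le> norm v" "\<exists>v\<in>V. norm v \<le> 1 \<and> norm (f v) > 1/2"
proof -
  obtain x where x: "x \<in> V" "x \<notin> span S" using assms(3) by blast
  obtain f where f: "bounded_functional smul f" "\<forall>s\<in>S. f s = 0" "f x \<noteq> 0"
    using functional_separating_span[OF assms(2) x(2)] by blast
  have zero: "bounded_functional smul (\<lambda>_. 0)" using functional_combination[OF f(1) f(1), of 0 0] by simp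
  have nz: "\<exists>v\<in>V. f v \<noteq> 0" using f(3) x(1) by blast
  obtain m u w where m: "m > 0" "m = (norm u)\<^sup>2 + (norm w)\<^sup>2"
    "\<And>v. v \<in> V \<Longrightarrow> (norm (f v))\<^sup>2 + (norm (0::'k))\<^sup>2 \<le> m * (norm v)\<^sup>2"
    "\<And>t. t < 1 \<Longrightarrow> \<exists>v\<in>V. norm v \<le> 1 \<and> norm (conj u * f v + conj w * 0) > t * m"
    by (rule hilbertian_pair[OF f(1) zero V nz]) (rule that; assumption)
  define h where "h v = (conj u / of_real m) * f v + 0 * f v" for v
  have hV: "norm (h v) \<le> norm v" if "v \<in> V" for v
  proof -
    \<comment> \<open>The rotation identity with \<open>b = 0\<close> bounds
      \<open>conj u * f v\<close> without computing \<open>w\<close> or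
      \<open>norm (conj u)\<close>.\<close>
    have "(norm (conj u * f v))\<^sup>2 + (norm (w * f v))\<^sup>2
        = ((norm u)\<^sup>2 + (norm w)\<^sup>2) * (norm (f v))\<^sup>2"
      using norm_rotation[of u "f v" w 0] by simp
    then have "(norm (conj u * f v))\<^sup>2 \<le> ((norm u)\<^sup>2 + (norm w)\<^sup>2) * (norm (f v))\<^sup>2"
      using zero_le_power2[of "norm (w * f v)"] by linarith
    also have "\<dots> \<le> m * (m * (norm v)\<^sup>2)" unfolding m(2)[symmetric]
      using m(1) m(3)[OF that] by (intro mult_left_mono) auto
    also have "\<dots> = (m * norm v)\<^sup>2" by (simp add: power2_eq_square)
    finally have "norm (conj u * f v) \<le> m * norm v"
      by (rule power2_le_imp_le) (use m(1) in simp)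
    then show ?thesis using m(1) by (simp add: h_def norm_mult norm_divide field_simps)
  qed
  have "\<exists>v\<in>V. norm v \<le> 1 \<and> norm (h v) > 1/2"
    using m(4)[of "1/2"] m(1) by (auto simp: h_def norm_mult norm_divide field_simps)
  moreover have "h s = 0" if "s \<in> S" for s using f(2) that by (simp add: h_def)
  moreover have "bounded_functional smul h"
    unfolding h_def by (rule functional_combination[OF f(1) f(1)])
  ultimately show ?thesis by (intro that[of h] hV)
qed

text \<open>The matrix with rows \<open>(conj u, conj w)\<close> and \<open>(- w, u)\<close>,
  divided by the square root of \<open>m\<close>, is unitary and turns the extremal direction
  \<open>(u, w)\<close> into the first axis. A second division by that root scales the pair below
  the norm; hence the denominators \<open>m\<close>.\<close>

lemma normalised_hilbertian_pair:
  assumes V: "subspace V" and "dim_at_least smul 2 V"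
  obtains \<phi> \<psi> where "bounded_functional smul \<phi>" "bounded_functional smul \<psi>"
    "\<And>v. v \<in> V \<Longrightarrow> (norm (\<phi> v))\<^sup>2 + (norm (\<psi> v))\<^sup>2 \<le> (norm v)\<^sup>2"
    "\<And>t. t < 1 \<Longrightarrow> \<exists>v\<in>V. norm v \<le> 1 \<and> norm (\<phi> v) > t"
    "\<exists>v\<in>V. norm v \<le> 1 \<and> \<psi> v \<noteq> 0"
proof -
  obtain B where B: "B \<subseteq> V" "card B = 2" "\<not> dependent B"
    using assms(2) by (auto simp: dim_at_least_def)
  then obtain x y where xy: "B = {x, y}" "x \<noteq> y" by (auto simp: card_2_iff)
  have "x \<notin> span {y}" "y \<notin> span {x}"
    using B(3) xy unfolding dependent_def by (auto simp: insert_Diff_if)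
  then obtain f g where f: "bounded_functional smul f" "f y = 0" "f x \<noteq> 0"
    and g: "bounded_functional smul g" "g x = 0" "g y \<noteq> 0"
    using functional_separating_span[of "{y}" x] functional_separating_span[of "{x}" y] by auto
  have V': "x \<in> V" "y \<in> V" using B(1) xy by auto
  have nz: "\<exists>v\<in>V. f v \<noteq> 0" using f(3) V' by blast
  obtain m u w where m: "m > 0" "m = (norm u)\<^sup>2 + (norm w)\<^sup>2"
    "\<And>v. v \<in> V \<Longrightarrow> (norm (f v))\<^sup>2 + (norm (g v))\<^sup>2 \<le> m * (norm v)\<^sup>2"
    "\<And>t. t < 1 \<Longrightarrow> \<exists>v\<in>V. norm v \<le> 1 \<and> norm (conj u * f v + conj w * g v) > t * m"
    by (rule hilbertian_pair[OF f(1) g(1) V nz]) (rule that; assumption)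
  define \<phi> where "\<phi> v = (conj u / of_real m) * f v + (conj w / of_real m) * g v" for v
  define \<psi> where "\<psi> v = (- w / of_real m) * f v + (u / of_real m) * g v" for v
  have \<phi>: "\<phi> v = (conj u * f v + conj w * g v) / of_real m" for v
    by (simp add: \<phi>_def add_divide_distrib)
  have \<psi>: "\<psi> v = (u * g v - w * f v) / of_real m" for v
    by (simp add: \<psi>_def diff_divide_distrib)
  have squares: "(norm (\<phi> v))\<^sup>2 + (norm (\<psi> v))\<^sup>2 \<le> (norm v)\<^sup>2" if "v \<in> V" for v
  proof -
    have "(norm (\<phi> v))\<^sup>2 + (norm (\<psi> v))\<^sup>2
        = ((norm (conj u * f v + conj w * g v))\<^sup>2 + (norm (u * g v - w * f v))\<^sup>2) / m\<^sup>2"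
      unfolding \<phi> \<psi> norm_divide power_divide by (simp add: add_divide_distrib)
    also have "\<dots> = (m * ((norm (f v))\<^sup>2 + (norm (g v))\<^sup>2)) / m\<^sup>2"
      unfolding norm_rotation m(2)[symmetric] ..
    also have "\<dots> \<le> (m * (m * (norm v)\<^sup>2)) / m\<^sup>2"
      using m(1) m(3)[OF that] by (intro divide_right_mono mult_left_mono) auto
    finally show ?thesis using m(1) by (simp add: power2_eq_square)
  qed
  have near: "\<exists>v\<in>V. norm v \<le> 1 \<and> norm (\<phi> v) > t" if "t < 1" for t
    using m(4)[OF that] m(1) by (auto simp: \<phi> norm_divide field_simps)
  have "u \<noteq> 0 \<or> w \<noteq> 0" using m(1,2) by auto
  \<comment> \<open>Since \<open>g x = 0\<close> and \<open>f y = 0\<close>, these values are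
    \<open>- w * f x\<close> and \<open>u * g y\<close>, both divided by \<open>m\<close>.\<close>
  then have "\<psi> x \<noteq> 0 \<or> \<psi> y \<noteq> 0" using f g m(1) by (auto simp: \<psi>)
  then obtain v where v: "v \<in> V" "\<psi> v \<noteq> 0" using V' by blast
  have functionals: "bounded_functional smul \<phi>" "bounded_functional smul \<psi>"
    unfolding \<phi>_def \<psi>_def by (intro functional_combination f g)+
  have "\<exists>v\<in>V. norm v \<le> 1 \<and> \<psi> v \<noteq> 0"
  proof (intro bexI conjI)
    let ?c = "of_real (inverse (norm v)) :: 'k"
    have "v \<noteq> 0" using v functional_zero[OF functionals(2)] by auto
    then show "norm (smul ?c v) \<le> 1" "\<psi> (smul ?c v) \<noteq> 0"
      using v by (simp_all add: norm_scale functional_scale[OF functionals(2)] norm_inverse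
          del: of_real_inverse)
    show "smul ?c v \<in> V" using V v by (intro subspace_scale)
  qed
  then show ?thesis by (intro that[of \<phi> \<psi>] functionals squares near)
qed

end

section \<open>Weak-star convergence of contractive forms\<close>

text \<open>This is norm at most one, stated as the estimate that applies to each term of a tensor
  representation; it also keeps the supremum in \<open>form_norm\<close> finite.\<close>

definition contractive_form ::
    "nat \<Rightarrow> (nat \<Rightarrow> 'a::real_normed_vector set) \<Rightarrow> ((nat \<Rightarrow> 'a) \<Rightarrow> 'k::real_normed_field) \<Rightarrow> bool" where
  "contractive_form n X A \<longleftrightarrow> (\<forall>x\<in>(\<Pi>\<^sub>E i\<in>{1..n}. X i). norm (A x) \<le> (\<Prod>i\<in>{1..n}. norm (x i)))"

lemma contractive_form_le_one:
  assumes "contractive_form n X A" "x \<in> (\<Pi>\<^sub>E i\<in>{1..n}. {v \<in> X i. norm v \<le> 1})"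
  shows "norm (A x) \<le> 1"
proof -
  have "norm (A x) \<le> (\<Prod>i\<in>{1..n}. norm (x i))"
    using assms by (auto simp: contractive_form_def PiE_iff)
  also have "\<dots> \<le> 1"
    using assms(2) by (intro prod_le_1) (auto simp: PiE_iff)
  finally show ?thesis .
qed

lemma le_form_norm:
  assumes "contractive_form n X A" "x \<in> (\<Pi>\<^sub>E i\<in>{1..n}. {v \<in> X i. norm v \<le> 1})"
  shows "norm (A x) \<le> form_norm n X A"
  unfolding form_norm_def
  by (rule cSUP_upper[OF assms(2)], rule bdd_aboveI2[where M = 1])
    (rule contractive_form_le_one[OF assms(1)])

lemma form_norm_le_one:
  assumes "contractive_form n X A" "\<And>i. i \<in> {1..n} \<Longrightarrow> 0 \<in> X i"
  shows "form_norm n X A \<le> 1"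
proof -
  have "(\<lambda>i\<in>{1..n}. 0) \<in> (\<Pi>\<^sub>E i\<in>{1..n}. {v \<in> X i. norm v \<le> 1})"
    using assms(2) by auto
  then show ?thesis unfolding form_norm_def
    by (intro cSUP_least contractive_form_le_one[OF assms(1)]) blast
qed

lemma tensor_apply_superset:
  assumes "finite K" "Poly_Mapping.keys u \<subseteq> K"
  shows "tensor_apply A u = (\<Sum>x\<in>K. Poly_Mapping.lookup u x * A x)"
  unfolding tensor_apply_def using assms
  by (intro sum.mono_neutral_left) (auto simp: in_keys_iff)

lemma tensor_apply_diff: "tensor_apply A (u - v) = tensor_apply A u - tensor_apply A v"
proof -
  let ?K = "Poly_Mapping.keys u \<union> Poly_Mapping.keys v"
  have "Poly_Mapping.keys (u - v) \<subseteq> ?K" by (rule keys_diff)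
  then show ?thesis
    by (simp add: tensor_apply_superset[where K = ?K] lookup_minus left_diff_distrib sum_subtractf)
qed

lemma tensor_reps_diff: "u \<in> tensor_reps n X \<Longrightarrow> v \<in> tensor_reps n X \<Longrightarrow> u - v \<in> tensor_reps n X"
  using keys_diff[of u v] by (auto simp: tensor_reps_def)

text \<open>All representations of a tensor give the same value of \<open>A\<close>, and each bounds
  it termwise; so does the infimum over them.\<close>

lemma norm_tensor_apply_le_proj_norm:
  assumes A: "A \<in> multilinear_forms smul n X" "contractive_form n X A" and u: "u \<in> tensor_reps n X"
  shows "norm (tensor_apply A u) \<le> proj_norm smul n X u"
  unfolding proj_norm_def
proof (rule cINF_greatest)
  show "{v \<in> tensor_reps n X. tensor_eq smul n X u v} \<noteq> {}"
    using u by (auto simp: tensor_eq_def)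
next
  fix v assume v: "v \<in> {v \<in> tensor_reps n X. tensor_eq smul n X u v}"
  then have "tensor_apply A u = tensor_apply A v"
    using A(1) by (auto simp: tensor_eq_def)
  also have "norm \<dots> \<le> (\<Sum>x\<in>Poly_Mapping.keys v. norm (Poly_Mapping.lookup v x) * norm (A x))"
    unfolding tensor_apply_def by (intro sum_norm_le) (simp add: norm_mult)
  also have "\<dots> \<le> (\<Sum>x\<in>Poly_Mapping.keys v.
      norm (Poly_Mapping.lookup v x) * (\<Prod>i\<in>{1..n}. norm (x i)))"
    using v A(2) by (intro sum_mono mult_left_mono) (auto simp: tensor_reps_def contractive_form_def)
  finally show "norm (tensor_apply A u) \<le> \<dots>" .
qed

text \<open>The point is that \<open>N\<close> does not depend on \<open>A\<close>: on contractive
  forms the pairing is uniformly close to evaluation at one finite sum of elementary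
  tensors.\<close>

lemma tensor_apply_near_pairing:
  fixes smul :: "'k::{real_normed_field,complete_space} \<Rightarrow> 'a::real_normed_vector \<Rightarrow> 'a"
  assumes u: "u \<in> proj_tensor_cauchy smul n X" and "e > 0"
  obtains N where "\<And>A. A \<in> multilinear_forms smul n X \<Longrightarrow> contractive_form n X A \<Longrightarrow>
    norm (tensor_apply A (u N) - proj_pairing A u) \<le> e"
proof -
  have rep: "u k \<in> tensor_reps n X" for k using u by (simp add: proj_tensor_cauchy_def)
  have close: "norm (tensor_apply A (u k) - tensor_apply A (u l)) \<le> proj_norm smul n X (u k - u l)"
    if "A \<in> multilinear_forms smul n X" "contractive_form n X A" for A k l
    using norm_tensor_apply_le_proj_norm[OF that tensor_reps_diff[OF rep rep]]
    by (simp add: tensor_apply_diff)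
  obtain N where N: "\<And>k l. k \<ge> N \<Longrightarrow> l \<ge> N \<Longrightarrow> proj_norm smul n X (u k - u l) < e"
    using u \<open>e > 0\<close> unfolding proj_tensor_cauchy_def by blast
  show ?thesis
  proof (rule that)
    fix A assume A: "A \<in> multilinear_forms smul n X" "contractive_form n X A"
    \<comment> \<open>Together with completeness this makes the \<open>lim\<close> in
      \<open>proj_pairing\<close> a genuine limit.\<close>
    have "Cauchy (\<lambda>k. tensor_apply A (u k))"
    proof (rule CauchyI)
      fix d :: real assume "d > 0"
      then obtain M where "\<forall>k\<ge>M. \<forall>l\<ge>M. proj_norm smul n X (u k - u l) < d"
        using u unfolding proj_tensor_cauchy_def by blast
      then show "\<exists>M. \<forall>k\<ge>M. \<forall>l\<ge>M. norm (tensor_apply A (u k) - tensor_apply A (u l)) < d"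
        using close[OF A] by (meson le_less_trans)
    qed
    then have "(\<lambda>k. tensor_apply A (u k)) \<longlonglongrightarrow> proj_pairing A u"
      unfolding proj_pairing_def by (simp add: Cauchy_convergent convergent_LIMSEQ_iff[symmetric])
    then have "(\<lambda>k. norm (tensor_apply A (u N) - tensor_apply A (u k)))
        \<longlonglongrightarrow> norm (tensor_apply A (u N) - proj_pairing A u)"
      by (intro tendsto_intros)
    moreover have "\<forall>\<^sub>F k in sequentially. norm (tensor_apply A (u N) - tensor_apply A (u k)) \<le> e"
      using close[OF A, of N] N[of N] by (intro eventually_sequentiallyI[of N]) (meson le_refl less_imp_le order_trans)
    ultimately show "norm (tensor_apply A (u N) - proj_pairing A u) \<le> e"
      by (rule tendsto_upperbound) simp
  qed
qed

text \<open>A three-epsilon argument: pointwise convergence handles the finite sum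
  \<open>u N\<close>, and the uniform approximation handles the passage to the pairing for
  \<open>G s\<close> and for \<open>A\<close>.\<close>

lemma limitin_weak_star_topology:
  fixes smul :: "'k::{real_normed_field,complete_space} \<Rightarrow> 'a::real_normed_vector \<Rightarrow> 'a"
  assumes A: "A \<in> cont_multilinear_forms smul n X" "contractive_form n X A"
    and G: "\<forall>\<^sub>F s in F. G s \<in> cont_multilinear_forms smul n X \<and> contractive_form n X (G s)"
    and pointwise: "\<And>x. x \<in> (\<Pi>\<^sub>E i\<in>{1..n}. X i) \<Longrightarrow> ((\<lambda>s. G s x) \<longlongrightarrow> A x) F"
  shows "limitin (weak_star_topology smul n X) G A F"
proof -
  let ?\<Phi> = "\<lambda>A. \<lambda>u\<in>proj_tensor_cauchy smul n X. proj_pairing A u"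
  have pairing: "((\<lambda>s. proj_pairing (G s) u) \<longlongrightarrow> proj_pairing A u) F"
    if u: "u \<in> proj_tensor_cauchy smul n X" for u
  proof (rule tendstoI)
    fix e :: real assume "e > 0"
    then obtain N where N: "\<And>A. A \<in> multilinear_forms smul n X \<Longrightarrow> contractive_form n X A \<Longrightarrow>
        norm (tensor_apply A (u N) - proj_pairing A u) \<le> e / 3"
      using tensor_apply_near_pairing[OF u, of "e / 3"] by (metis zero_less_divide_iff zero_less_numeral)
    have "Poly_Mapping.keys (u N) \<subseteq> (\<Pi>\<^sub>E i\<in>{1..n}. X i)"
      using u by (auto simp: proj_tensor_cauchy_def tensor_reps_def)
    then have "((\<lambda>s. tensor_apply (G s) (u N)) \<longlongrightarrow> tensor_apply A (u N)) F"
      unfolding tensor_apply_def by (intro tendsto_intros pointwise) auto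
    then have "\<forall>\<^sub>F s in F. dist (tensor_apply (G s) (u N)) (tensor_apply A (u N)) < e / 3"
      using \<open>e > 0\<close> by (intro tendstoD) auto
    then show "\<forall>\<^sub>F s in F. dist (proj_pairing (G s) u) (proj_pairing A u) < e"
      using G
    proof eventually_elim
      case (elim s)
      have "norm (tensor_apply (G s) (u N) - proj_pairing (G s) u) \<le> e / 3"
        "norm (tensor_apply A (u N) - proj_pairing A u) \<le> e / 3"
        using elim A by (intro N; simp add: cont_multilinear_forms_def)+
      then show ?case
        using elim(1) dist_triangle[of "proj_pairing (G s) u" "proj_pairing A u" "tensor_apply A (u N)"]
          dist_triangle[of "proj_pairing (G s) u" "tensor_apply A (u N)" "tensor_apply (G s) (u N)"]
        unfolding dist_norm[symmetric] by (simp add: dist_commute)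
    qed
  qed
  have "limitin (product_topology (\<lambda>u. euclidean) (proj_tensor_cauchy smul n X))
      (\<lambda>s. ?\<Phi> (G s)) (?\<Phi> A) F"
    unfolding limitin_componentwise using pairing by auto
  then have lim: "\<forall>\<^sub>F s in F. ?\<Phi> (G s) \<in> U"
    if "openin (product_topology (\<lambda>u. euclidean) (proj_tensor_cauchy smul n X)) U" "?\<Phi> A \<in> U" for U
    using that by (auto simp: limitin_def)
  show ?thesis
    unfolding limitin_def
  proof (intro conjI allI impI)
    show "A \<in> topspace (weak_star_topology smul n X)"
      using A by (auto simp: weak_star_topology_def topspace_pullback_topology)
  next
    fix W assume "openin (weak_star_topology smul n X) W \<and> A \<in> W"
    then obtain U where U: "openin (product_topology (\<lambda>u. euclidean) (proj_tensor_cauchy smul n X)) U"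
        "W = ?\<Phi> -` U \<inter> cont_multilinear_forms smul n X" "?\<Phi> A \<in> U"
      by (auto simp: weak_star_topology_def openin_pullback_topology)
    show "\<forall>\<^sub>F s in F. G s \<in> W"
      using lim[OF U(1,3)] G by eventually_elim (auto simp: U(2))
  qed
qed

text \<open>Cauchy-Schwarz bounds \<open>a q * a r + b q * b r\<close> by \<open>N q * N r\<close>,
  and all other factors are bounded by \<open>N i\<close> in both products. One index with the
  square condition would only give this up to a factor of the square root of two; this is why two
  indices besides \<open>p\<close> are used.\<close>

lemma prod_add_prod_le:
  fixes a b N :: "'i \<Rightarrow> real"
  assumes "finite I" "q \<in> I" "r \<in> I" "q \<noteq> r"
    and nonneg: "\<And>i. i \<in> I \<Longrightarrow> 0 \<le> a i" "\<And>i. i \<in> I \<Longrightarrow> 0 \<le> b i" "\<And>i. i \<in> I \<Longrightarrow> 0 \<le> N i"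
    and le: "\<And>i. i \<in> I - {q, r} \<Longrightarrow> a i \<le> N i" "\<And>i. i \<in> I - {q, r} \<Longrightarrow> b i \<le> N i"
    and sq: "\<And>i. i \<in> {q, r} \<Longrightarrow> (a i)\<^sup>2 + (b i)\<^sup>2 \<le> (N i)\<^sup>2"
  shows "prod a I + prod b I \<le> prod N I"
proof -
  let ?J = "I - {q, r}"
  have split: "prod f I = (f q * f r) * prod f ?J" for f :: "'i \<Rightarrow> real"
  proof -
    have "prod f I = f q * (f r * prod f (I - {q} - {r}))"
      using assms(1-4) by (simp add: prod.remove[of I q] prod.remove[of "I - {q}" r])
    then show ?thesis by (simp add: Diff_insert2[symmetric] mult.assoc insert_commute)
  qed
  have N0: "0 \<le> prod N ?J" using nonneg by (intro prod_nonneg) auto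
  \<comment> \<open>Lagrange's identity: the two sides differ by the square of
    \<open>a q * b r - a r * b q\<close>.\<close>
  have "(a q * a r + b q * b r)\<^sup>2 \<le> ((a q)\<^sup>2 + (b q)\<^sup>2) * ((a r)\<^sup>2 + (b r)\<^sup>2)"
    using zero_le_power2[of "a q * b r - a r * b q"] by (simp add: power2_eq_square algebra_simps)
  also have "\<dots> \<le> (N q)\<^sup>2 * (N r)\<^sup>2" using sq by (intro mult_mono) auto
  also have "\<dots> = (N q * N r)\<^sup>2" by (simp add: power_mult_distrib)
  finally have cs: "a q * a r + b q * b r \<le> N q * N r"
    by (rule power2_le_imp_le) (use nonneg assms(2,3) in simp)
  have "prod a I + prod b I \<le> (a q * a r) * prod N ?J + (b q * b r) * prod N ?J"
    unfolding split[of a] split[of b] using nonneg le assms(2,3)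
    by (intro add_mono mult_left_mono prod_mono) auto
  also have "\<dots> \<le> (N q * N r) * prod N ?J"
    using mult_right_mono[OF cs N0] by (simp add: algebra_simps)
  finally show ?thesis unfolding split[of N] .
qed

section \<open>Products of functionals as multilinear forms\<close>

definition product_form ::
    "nat \<Rightarrow> (nat \<Rightarrow> 'a set) \<Rightarrow> (nat \<Rightarrow> 'a \<Rightarrow> 'k) \<Rightarrow> (nat \<Rightarrow> 'a) \<Rightarrow> 'k::real_normed_field" where
  "product_form n X h x = (if x \<in> (\<Pi>\<^sub>E i\<in>{1..n}. X i) then \<Prod>i\<in>{1..n}. h i (x i) else 0)"

lemma cont_multilinear_forms_add:
  assumes "A \<in> cont_multilinear_forms smul n X" "B \<in> cont_multilinear_forms smul n X"
  shows "(\<lambda>x. A x + B x) \<in> cont_multilinear_forms smul n X"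
  using assms
  by (auto simp: cont_multilinear_forms_def multilinear_forms_def algebra_simps
      intro: continuous_map_add)

context separated_normed_space
begin

lemma product_form_multilinear:
  assumes h: "\<And>i. i \<in> {1..n} \<Longrightarrow> bounded_functional smul (h i)"
    and X: "\<And>i. i \<in> {1..n} \<Longrightarrow> subspace (X i)"
  shows "product_form n X h \<in> cont_multilinear_forms smul n X"
proof -
  \<comment> \<open>Isolating the factor at \<open>i\<close> reduces both linearity conditions to
    those of \<open>h i\<close>.\<close>
  have upd: "product_form n X h (x(i := y)) = h i y * (\<Prod>j\<in>{1..n} - {i}. h j (x j))"
    if "x \<in> (\<Pi>\<^sub>E i\<in>{1..n}. X i)" "i \<in> {1..n}" "y \<in> X i" for x i y
  proof -
    have "x(i := y) \<in> (\<Pi>\<^sub>E i\<in>{1..n}. X i)" using that by (auto simp: PiE_iff extensional_def)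
    moreover have "(\<Prod>j\<in>{1..n} - {i}. h j ((x(i := y)) j)) = (\<Prod>j\<in>{1..n} - {i}. h j (x j))"
      by (intro prod.cong) auto
    ultimately show ?thesis using that(2) by (simp add: product_form_def prod.remove[of _ i])
  qed
  have "product_form n X h \<in> multilinear_forms smul n X"
    unfolding multilinear_forms_def
  proof (intro CollectI conjI allI ballI impI)
    show "product_form n X h x = 0" if "x \<notin> (\<Pi>\<^sub>E i\<in>{1..n}. X i)" for x
      using that by (simp add: product_form_def)
  next
    fix x i y z assume x: "x \<in> (\<Pi>\<^sub>E i\<in>{1..n}. X i)" "i \<in> {1..n}" and yz: "y \<in> X i" "z \<in> X i"
    then have "y + z \<in> X i" using X subspace_add by blast
    then show "product_form n X h (x(i := y + z)) = product_form n X h (x(i := y)) + product_form n X h (x(i := z))"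
      by (simp only: upd[OF x] yz functional_add[OF h[OF x(2)]] distrib_right)
  next
    fix x i c y assume x: "x \<in> (\<Pi>\<^sub>E i\<in>{1..n}. X i)" "i \<in> {1..n}" and y: "y \<in> X i"
    then have "smul c y \<in> X i" using X subspace_scale by blast
    then show "product_form n X h (x(i := smul c y)) = c * product_form n X h (x(i := y))"
      by (simp only: upd[OF x] y functional_scale[OF h[OF x(2)]] mult.assoc)
  qed
  moreover have "continuous_map (product_topology (\<lambda>i. top_of_set (X i)) {1..n}) euclidean
      (\<lambda>x. \<Prod>i\<in>{1..n}. h i (x i))"
  proof -
    have "continuous_map (product_topology (\<lambda>i. top_of_set (X i)) {1..n}) euclidean (\<lambda>x. h i (x i))"
      if "i \<in> {1..n}" for i
    proof -
      have "continuous_map (product_topology (\<lambda>i. top_of_set (X i)) {1..n}) (top_of_set (X i)) (\<lambda>x. x i)"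
        using continuous_map_product_projection[OF that, of "\<lambda>i. top_of_set (X i)"] .
      moreover have "continuous_map (top_of_set (X i)) euclidean (h i)"
        using continuous_on_subset[OF functional_continuous[OF h[OF that]] subset_UNIV] by simp
      ultimately show ?thesis
        unfolding o_def[of "h i" "\<lambda>x. x i", symmetric] by (rule continuous_map_compose)
    qed
    then show ?thesis 
      unfolding continuous_map_atin limitin_canonical_iff by (intro ballI tendsto_prod) blast
  qed
  then have "continuous_map (product_topology (\<lambda>i. top_of_set (X i)) {1..n}) euclidean
      (product_form n X h)"
    by (rule continuous_map_eq) (auto simp: product_form_def)
  ultimately show ?thesis by (simp add: cont_multilinear_forms_def)
qed

end

section \<open>Failure of the weak-star Kadec--Klee property\<close>

context separated_normed_space
begin

theorem not_multilinear_forms_KK: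
  assumes n: "n \<ge> 3"
    and X: "\<And>i. i \<in> {1..n} \<Longrightarrow> subspace (X i)" "\<And>i. i \<in> {1..n} \<Longrightarrow> dim_at_least smul 2 (X i)"
    and inf: "\<exists>i\<in>{1..n}. infinite_dimensional smul (X i)"
  shows "\<not> multilinear_forms_KK smul n X"
proof
  assume KK: "multilinear_forms_KK smul n X"
  let ?I = "{1..n}"
  obtain p where p: "p \<in> ?I" "infinite_dimensional smul (X p)" using inf by blast
  have "card (?I - {p}) \<ge> 2" using n p by simp
  then obtain T where "T \<subseteq> ?I - {p}" "card T = 2"
    by (rule obtain_subset_with_card_n)
  then obtain q r where qr: "q \<in> ?I - {p}" "r \<in> ?I - {p}" "q \<noteq> r"
    unfolding card_2_iff by blast
  have I: "q \<in> ?I" "r \<in> ?I" "p \<noteq> q" "p \<noteq> r" using qr by auto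

  \<comment> \<open>All requirements are bundled into one predicate so that a single choice fixes
    both functionals for every index.\<close>
  define good where "good i f g \<longleftrightarrow> bounded_functional smul f \<and> bounded_functional smul g \<and>
    (\<forall>v\<in>X i. (norm (f v))\<^sup>2 + (norm (g v))\<^sup>2 \<le> (norm v)\<^sup>2) \<and>
    (\<forall>t<1. \<exists>v\<in>X i. norm v \<le> 1 \<and> norm (f v) > t) \<and> (\<exists>v\<in>X i. norm v \<le> 1 \<and> g v \<noteq> 0)" for i f g
  have "\<exists>f g. good i f g" if "i \<in> ?I" for i
    by (rule normalised_hilbertian_pair[OF X[OF that]]) (auto simp: good_def)
  then obtain f g where good: "\<And>i. i \<in> ?I \<Longrightarrow> good i (f i) (g i)" by metis
  have f: "bounded_functional smul (f i)" and g: "bounded_functional smul (g i)"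
    and sq: "\<And>v. v \<in> X i \<Longrightarrow> (norm (f i v))\<^sup>2 + (norm (g i v))\<^sup>2 \<le> (norm v)\<^sup>2"
    and near: "\<And>t. t < 1 \<Longrightarrow> \<exists>v\<in>X i. norm v \<le> 1 \<and> norm (f i v) > t"
    and gnz: "\<exists>v\<in>X i. norm v \<le> 1 \<and> g i v \<noteq> 0" if "i \<in> ?I" for i
    using good[OF that] by (auto simp: good_def)
  have fle: "norm (f i v) \<le> norm v" if "i \<in> ?I" "v \<in> X i" for i v
  proof (rule power2_le_imp_le)
    show "(norm (f i v))\<^sup>2 \<le> (norm v)\<^sup>2"
      using sq[OF that] zero_le_power2[of "norm (g i v)"] by linarith
  qed simp

  define vanishing where "vanishing S h \<longleftrightarrow> bounded_functional smul h \<and> (\<forall>s\<in>S. h s = 0) \<and>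
    (\<forall>v\<in>X p. norm (h v) \<le> norm v) \<and> (\<exists>v\<in>X p. norm v \<le> 1 \<and> norm (h v) > 1/2)" for S h
  have "\<exists>h. vanishing S h" if "finite S" "S \<subseteq> X p" for S
  proof -
    have "\<not> X p \<subseteq> span S" using p(2) that by (auto simp: infinite_dimensional_def)
    then show ?thesis
      by (rule normalised_functional_vanishing[OF X(1)[OF p(1)] that(1)]) (auto simp: vanishing_def)
  qed
  then obtain h where "\<And>S. finite S \<Longrightarrow> S \<subseteq> X p \<Longrightarrow> vanishing S (h S)" by metis
  then have h: "bounded_functional smul (h S)" and hS: "\<And>s. s \<in> S \<Longrightarrow> h S s = 0"
    and hle: "\<And>v. v \<in> X p \<Longrightarrow> norm (h S v) \<le> norm v"
    and hnear: "\<exists>v\<in>X p. norm v \<le> 1 \<and> norm (h S v) > 1/2"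
    if "finite S" "S \<subseteq> X p" for S
    using that by (auto simp: vanishing_def)

  \<comment> \<open>The factors of \<open>B S\<close>, except that the one at \<open>p\<close>,
    which differs from \<open>q\<close> and \<open>r\<close>, is overwritten by
    \<open>h S\<close>.\<close>
  define d where "d i = (if i \<in> {q, r} then g i else f i)" for i
  define A where "A = product_form n X f"
  define B where "B S = product_form n X (d(p := h S))" for S
  define G where "G S = (\<lambda>x. A x + B S x)" for S
  have d: "bounded_functional smul (d i)" if "i \<in> ?I" for i
    using f[OF that] g[OF that] by (simp add: d_def)

  have A: "A \<in> cont_multilinear_forms smul n X"
    unfolding A_def by (intro product_form_multilinear f X)
  have B: "B S \<in> cont_multilinear_forms smul n X" if "finite S" "S \<subseteq> X p" for S
    unfolding B_def using h[OF that] d X by (intro product_form_multilinear) auto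
  have G: "G S \<in> cont_multilinear_forms smul n X" if "finite S" "S \<subseteq> X p" for S
    unfolding G_def by (intro cont_multilinear_forms_add A B that)

  have sum_le: "norm (A x) + norm (B S x) \<le> (\<Prod>i\<in>?I. norm (x i))"
    if S: "finite S" "S \<subseteq> X p" and x: "x \<in> (\<Pi>\<^sub>E i\<in>?I. X i)" for S x
  proof -
    have xi: "x i \<in> X i" if "i \<in> ?I" for i using x that by (rule PiE_mem)
    have "(\<Prod>i\<in>?I. norm (f i (x i))) + (\<Prod>i\<in>?I. norm ((d(p := h S)) i (x i)))
        \<le> (\<Prod>i\<in>?I. norm (x i))"
    proof (rule prod_add_prod_le[of _ q r])
      show "norm ((d(p := h S)) i (x i)) \<le> norm (x i)" if "i \<in> ?I - {q, r}" for i
        using that hle[OF S] fle xi by (auto simp: d_def)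
      show "(norm (f i (x i)))\<^sup>2 + (norm ((d(p := h S)) i (x i)))\<^sup>2 \<le> (norm (x i))\<^sup>2"
        if "i \<in> {q, r}" for i
        using that I sq xi by (auto simp: d_def)
    qed (use I qr(3) fle xi in auto)
    then show ?thesis using x by (simp add: A_def B_def product_form_def prod_norm)
  qed
  \<comment> \<open>The bound for \<open>A\<close> does not involve \<open>S\<close>; it is used
    below with the empty set.\<close>
  have contr: "contractive_form n X A" "contractive_form n X (B S)" "contractive_form n X (G S)"
    if S: "finite S" "S \<subseteq> X p" for S
    using sum_le[OF S] norm_ge_zero norm_triangle_ineq
    unfolding contractive_form_def G_def by (smt (verit))+
  have zero: "0 \<in> X i" if "i \<in> ?I" for i using X(1)[OF that] by (rule subspace_0)

  have ball: "x \<in> (\<Pi>\<^sub>E i\<in>?I. X i)" if "x \<in> (\<Pi>\<^sub>E i\<in>?I. {v \<in> X i. norm v \<le> 1})" for x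
    using that by (auto simp: PiE_iff)
  \<comment> \<open>The functionals \<open>f i\<close> need not attain their norms, so that only approximate maximisers exist.\<close>
  have nearA: "\<exists>x\<in>(\<Pi>\<^sub>E i\<in>?I. {v \<in> X i. norm v \<le> 1}). norm (A x) \<ge> t ^ n" if t: "0 < t" "t < 1" for t
  proof -
    obtain v where v: "\<And>i. i \<in> ?I \<Longrightarrow> v i \<in> X i \<and> norm (v i) \<le> 1 \<and> norm (f i (v i)) > t"
      using near[OF _ t(2)] by metis
    define x where "x = restrict v ?I"
    have x: "x \<in> (\<Pi>\<^sub>E i\<in>?I. {v \<in> X i. norm v \<le> 1})"
      using v by (auto simp: x_def)
    have "(\<Prod>i\<in>?I. t) \<le> (\<Prod>i\<in>?I. norm (f i (x i)))"
      using v t by (intro prod_mono) (auto simp: x_def less_imp_le)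
    then have "t ^ n \<le> norm (A x)" using ball[OF x] by (simp add: A_def product_form_def prod_norm)
    then show ?thesis using x by blast
  qed
  have normA: "form_norm n X A = 1"
  proof (rule antisym)
    show "form_norm n X A \<le> 1" using contr(1)[of "{}"] zero by (intro form_norm_le_one) auto
    show "1 \<le> form_norm n X A"
    proof (rule tendsto_upperbound)
      have "((\<lambda>t::real. t ^ n) \<longlongrightarrow> 1 ^ n) (at_left 1)" by (intro tendsto_intros)
      then show "((\<lambda>t::real. t ^ n) \<longlongrightarrow> 1) (at_left 1)" by simp
      have "t ^ n \<le> form_norm n X A" if t: "0 < t" "t < 1" for t :: real
        using nearA[OF t] le_form_norm[OF contr(1)[of "{}"]] by fastforce
      then show "\<forall>\<^sub>F t in at_left 1. t ^ n \<le> form_norm n X A"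
        by (intro eventually_at_leftI[of 0]) auto
    qed simp
  qed
  have normG: "form_norm n X (G S) = 1" if S: "finite S" "S \<subseteq> X p" for S
  proof (rule antisym)
    show "form_norm n X (G S) \<le> 1" using contr(3)[OF S] zero by (intro form_norm_le_one) auto
    show "1 \<le> form_norm n X (G S)"
    proof (rule tendsto_upperbound)
      have "((\<lambda>t::real. 2 * t ^ n - 1) \<longlongrightarrow> 2 * 1 ^ n - 1) (at_left 1)" by (intro tendsto_intros)
      then show "((\<lambda>t::real. 2 * t ^ n - 1) \<longlongrightarrow> 1) (at_left 1)" by simp
      \<comment> \<open>Where \<open>A\<close> is at least \<open>t ^ n\<close> in modulus,
        \<open>B S\<close> is at most \<open>1 - t ^ n\<close>, so their sum is at least the
        difference of these two bounds.\<close>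
      have "2 * t ^ n - 1 \<le> form_norm n X (G S)" if t: "0 < t" "t < 1" for t :: real
      proof -
        obtain x where x: "x \<in> (\<Pi>\<^sub>E i\<in>?I. {v \<in> X i. norm v \<le> 1})" "norm (A x) \<ge> t ^ n"
          using nearA[OF t] by blast
        have "norm (A x) + norm (B S x) \<le> (\<Prod>i\<in>?I. norm (x i))"
          by (rule sum_le[OF S ball[OF x(1)]])
        also have "\<dots> \<le> 1" using x(1) by (intro prod_le_1) (auto simp: PiE_iff)
        finally have "norm (A x) + norm (B S x) \<le> 1" .
        moreover have "norm (A x) - norm (B S x) \<le> norm (G S x)"
          unfolding G_def by (metis norm_diff_ineq)
        ultimately have "2 * t ^ n - 1 \<le> norm (G S x)" using x(2) by linarith
        then show ?thesis using le_form_norm[OF contr(3)[OF S] x(1)] by linarith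
      qed
      then show "\<forall>\<^sub>F t in at_left 1. 2 * t ^ n - 1 \<le> form_norm n X (G S)"
        by (intro eventually_at_leftI[of 0]) auto
    qed simp
  qed

  have "\<exists>v\<in>X i. norm v \<le> 1 \<and> d i v \<noteq> 0" if "i \<in> ?I" for i
    using near[OF that, of 0] gnz[OF that] by (auto simp: d_def)
  then obtain v where v: "\<And>i. i \<in> ?I \<Longrightarrow> v i \<in> X i \<and> norm (v i) \<le> 1 \<and> d i (v i) \<noteq> 0" by metis
  \<comment> \<open>The factor \<open>1/2\<close> is the value that every \<open>h S\<close> exceeds
    on the unit ball; the other factors are taken at fixed points, so \<open>c\<close> is
    independent of \<open>S\<close>.\<close>
  define c where "c = 1/2 * (\<Prod>i\<in>?I - {p}. norm (d i (v i)))"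
  have "c > 0" unfolding c_def using v by (auto intro!: prod_pos)
  have normB: "c \<le> form_norm n X (B S)" if S: "finite S" "S \<subseteq> X p" for S
  proof -
    obtain z where z: "z \<in> X p" "norm z \<le> 1" "norm (h S z) > 1/2" using hnear[OF S] by blast
    define x where "x = (restrict v ?I)(p := z)"
    have x: "x \<in> (\<Pi>\<^sub>E i\<in>?I. {v \<in> X i. norm v \<le> 1})"
      using v z p(1) by (auto simp: x_def PiE_iff extensional_def)
    have "(\<Prod>i\<in>?I - {p}. norm ((d(p := h S)) i (x i))) = (\<Prod>i\<in>?I - {p}. norm (d i (v i)))"
      by (intro prod.cong) (auto simp: x_def)
    then have "norm (B S x) = norm (h S z) * (\<Prod>i\<in>?I - {p}. norm (d i (v i)))"
      using ball[OF x] p(1) by (simp add: B_def product_form_def norm_mult prod_norm[symmetric]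
          prod.remove[of _ p] x_def)
    moreover have "c \<le> norm (h S z) * (\<Prod>i\<in>?I - {p}. norm (d i (v i)))"
      unfolding c_def using z(3) by (intro mult_right_mono prod_nonneg) auto
    ultimately have "c \<le> norm (B S x)" by linarith
    then show ?thesis using le_form_norm[OF contr(2)[OF S] x] by linarith
  qed

  \<comment> \<open>The net is indexed by the finite subsets of \<open>X p\<close>, directed by
    inclusion.\<close>
  define F where "F = finite_subsets_at_top (X p)"
  have evS: "\<forall>\<^sub>F S in F. finite S \<and> S \<subseteq> X p"
    unfolding F_def by (rule eventually_finite_subsets_at_top_weakI) simp
  have "limitin (weak_star_topology smul n X) (\<lambda>g. g) A (filtermap G F)"
  proof (rule limitin_weak_star_topology[OF A contr(1)[of "{}"]])
    show "\<forall>\<^sub>F g in filtermap G F. g \<in> cont_multilinear_forms smul n X \<and> contractive_form n X g"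
      unfolding eventually_filtermap using evS by eventually_elim (auto intro: G contr)
    show "((\<lambda>g. g x) \<longlongrightarrow> A x) (filtermap G F)" if x: "x \<in> (\<Pi>\<^sub>E i\<in>?I. X i)" for x
      unfolding filterlim_filtermap
    proof (rule tendsto_eventually)
      \<comment> \<open>As soon as \<open>S\<close> contains \<open>x p\<close>, the factor
        \<open>h S\<close> annihilates \<open>B S\<close> at \<open>x\<close>, so the net is
        eventually constant at each point.\<close>
      have "x p \<in> X p" using x p(1) by (rule PiE_mem)
      then have "\<forall>\<^sub>F S in F. finite S \<and> {x p} \<subseteq> S \<and> S \<subseteq> X p"
        unfolding F_def eventually_finite_subsets_at_top by (intro exI[of _ "{x p}"]) auto
      then show "\<forall>\<^sub>F S in F. G S x = A x"
      proof eventually_elim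
        case (elim S)
        then have "h S (x p) = 0" using hS by auto
        then have "B S x = 0" unfolding B_def product_form_def using p(1)
          by (auto intro!: prod_zero bexI[of _ p])
        then show ?case by (simp add: G_def)
      qed
    qed
  qed auto
  moreover have "\<forall>\<^sub>F g in filtermap G F. g \<in> cont_multilinear_forms smul n X \<and> form_norm n X g = 1"
    unfolding eventually_filtermap using evS by eventually_elim (auto intro: G normG)
  ultimately have "((\<lambda>g. form_norm n X (g - A)) \<longlongrightarrow> 0) (filtermap G F)"
    using KK A normA unfolding multilinear_forms_KK_def weak_star_KK_def by blast
  then have "((\<lambda>S. form_norm n X (G S - A)) \<longlongrightarrow> 0) F"
    by (simp add: filterlim_filtermap)
  then have "\<forall>\<^sub>F S in F. form_norm n X (G S - A) < c"
    using \<open>c > 0\<close> by (rule order_tendstoD)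
  \<comment> \<open>The difference \<open>G S - A\<close> is \<open>B S\<close>, whose norm is at
    least \<open>c\<close>; this is absurd because \<open>F\<close> is a proper filter.\<close>
  then have "\<forall>\<^sub>F S in F. False"
    using evS
  proof eventually_elim
    case (elim S)
    have "G S - A = B S" by (auto simp: G_def fun_eq_iff)
    then show ?case using elim normB[of S] by auto
  qed
  then show False by (simp add: F_def trivial_limit_def[symmetric])
qed

end

section \<open>Real and complex scalars\<close>

lemma separated_normed_space_real:
  "separated_normed_space (scaleR :: real \<Rightarrow> 'a::real_normed_vector \<Rightarrow> 'a) (\<lambda>z. z)"
proof unfold_locales
  fix x :: 'a assume "x \<noteq> 0"
  obtain u :: "'a \<Rightarrow> real" where u: "linear u" "\<And>y. \<bar>u y\<bar> \<le> norm y" "u x = norm x"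
    using norming_functional_exists[of x] by blast
  have "bounded_functional scaleR u"
    unfolding bounded_functional_def
    using u(2) linear_add[OF u(1)] linear_scale[OF u(1)] by (auto intro: exI[of _ 1])
  then show "\<exists>f. bounded_functional (scaleR :: real \<Rightarrow> 'a \<Rightarrow> 'a) f \<and> f x \<noteq> 0"
    using u(3) \<open>x \<noteq> 0\<close> by (intro exI[of _ u]) simp
qed (auto simp: algebra_simps power2_eq_square)

lemma separated_normed_space_complex:
  fixes smul :: "complex \<Rightarrow> 'a::real_normed_vector \<Rightarrow> 'a"
  assumes "normed_space_over smul"
  shows "separated_normed_space smul cnj"
proof -
  interpret normed_space_over smul by fact
  show ?thesis
  proof unfold_locales
    show "cnj z * z = of_real ((norm z)\<^sup>2)" for z
      by (simp only: complex_norm_square mult.commute)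
    show "(norm (cnj u * a + cnj w * b))\<^sup>2 + (norm (u * b - w * a))\<^sup>2
        = ((norm u)\<^sup>2 + (norm w)\<^sup>2) * ((norm a)\<^sup>2 + (norm b)\<^sup>2)" for u a w b
      unfolding cmod_power2 by (simp add: power2_eq_square algebra_simps)
  next
    fix x :: 'a assume "x \<noteq> 0"
    obtain u :: "'a \<Rightarrow> real" where u: "linear u" "\<And>y. \<bar>u y\<bar> \<le> norm y" "u x = norm x"
      using norming_functional_exists[of x] by blast
    \<comment> \<open>The complex-linear functional whose real part is the real-linear
      \<open>u\<close>.\<close>
    define f where "f y = complex_of_real (u y) - \<i> * complex_of_real (u (smul \<i> y))" for y
    have scale_split: "smul c y = Re c *\<^sub>R y + Im c *\<^sub>R smul \<i> y" for c y
    proof -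
      have "smul c y = smul (of_real (Re c) + of_real (Im c) * \<i>) y"
        using complex_eq[of c] by (simp add: mult.commute)
      also have "\<dots> = smul (of_real (Re c)) y + smul (of_real (Im c)) (smul \<i> y)"
        by (simp only: scale_left_distrib scale_scale)
      finally show ?thesis by (simp only: scale_of_real)
    qed
    have ii: "smul \<i> (smul c y) = Re c *\<^sub>R smul \<i> y - Im c *\<^sub>R y" for c y
      using scale_split[of "\<i> * c" y] by simp
    have "f (y + z) = f y + f z" for y z
      by (simp add: f_def scale_right_distrib linear_add[OF u(1)] algebra_simps)
    moreover have "f (smul c y) = c * f y" for c y
    proof -
      have "u (smul c y) = Re c * u y + Im c * u (smul \<i> y)"
        unfolding scale_split[of c y] by (simp add: linear_add[OF u(1)] linear_scale[OF u(1)])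
      moreover have "u (smul \<i> (smul c y)) = Re c * u (smul \<i> y) - Im c * u y"
        unfolding ii by (simp add: linear_diff[OF u(1)] linear_scale[OF u(1)])
      ultimately show ?thesis by (simp add: f_def complex_eq_iff algebra_simps)
    qed
    \<comment> \<open>A crude constant is enough, since only boundedness and
      \<open>f x \<noteq> 0\<close> are required.\<close>
    moreover have "norm (f y) \<le> 2 * norm y" for y
    proof -
      have "norm (f y) \<le> \<bar>u y\<bar> + \<bar>u (smul \<i> y)\<bar>"
        unfolding f_def using norm_triangle_ineq4[of "complex_of_real (u y)" "\<i> * complex_of_real (u (smul \<i> y))"]
        by (simp add: norm_mult)
      also have "\<dots> \<le> norm y + norm (smul \<i> y)" by (intro add_mono u)
      finally show ?thesis by (simp add: norm_scale)
    qed
    ultimately have "bounded_functional smul f" unfolding bounded_functional_def by blast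
    moreover have "Re (f x) = norm x" by (simp add: f_def u(3))
    then have "f x \<noteq> 0" using \<open>x \<noteq> 0\<close> by auto
    ultimately show "\<exists>f. bounded_functional smul f \<and> f x \<noteq> 0" by blast
  qed
qed

theorem theorem5p8:
  fixes n :: nat
  assumes "n \<ge> 3"
  shows
    "(\<forall>X :: nat \<Rightarrow> 'a::real_normed_vector set.
        (\<forall>i\<in>{1..n}. banach_subspace scaleR (X i) \<and> dim_at_least scaleR 2 (X i)) \<longrightarrow>
        (\<exists>i\<in>{1..n}. infinite_dimensional scaleR (X i)) \<longrightarrow>
        \<not> multilinear_forms_KK scaleR n X) \<and>
     (\<forall>(smul :: complex \<Rightarrow> 'b::real_normed_vector \<Rightarrow> 'b) (X :: nat \<Rightarrow> 'b set).
        normed_space_over smul \<longrightarrow>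
        (\<forall>i\<in>{1..n}. banach_subspace smul (X i) \<and> dim_at_least smul 2 (X i)) \<longrightarrow>
        (\<exists>i\<in>{1..n}. infinite_dimensional smul (X i)) \<longrightarrow>
        \<not> multilinear_forms_KK smul n X)"
  using separated_normed_space.not_multilinear_forms_KK[OF separated_normed_space_real assms]
    separated_normed_space.not_multilinear_forms_KK[OF separated_normed_space_complex assms]
  unfolding banach_subspace_def by blast

end
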